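(* Let $L$ be a transitive linear order and $\overline{L}$ a cyclically transitive linear order. Then $L\cdot\overline{L}$ is cyclically transitive. Moreover, if $L$ is unbounded or discrete then so is $L\cdot\overline{L}$ (that is, if $L$ is unbounded then $L\cdot\overline{L}$ is unbounded, and if $L$ is discrete then $L\cdot\overline{L}$ is discrete).
   Context: Linear orders may be empty. $L_1+L_2$ denotes the ordered sum (every element of $L_1$ strictly below every element of $L_2$); a partition $L=L_1+L_2$ means that $L_1$ is an initial segment of $L$ and $L_2$ is its complement (either may be empty). The product $L_1\cdot L_2$ is $L_1\times L_2$ with the colexicographic order (the second coordinate takes precedence over the first). A linear order $L$ is transitive if for any $a,b\in L$ there is an order automorphism $\phi$ of $L$ with $\phi(a)=b$. $L$ is cyclically transitive if for any $a\le b$ in $L$ there exist partitions $L=L_1+L_2=L_2'+L_1'$ with $a\in L_1$, $b\in L_1'$, and order isomorphisms $F_1:L_1\to L_1'$, $F_2:L_2\to L_2'$ satisfying $F_1(a)=b$. $L$ is unbounded if for each $a\in L$ there are $b,c\in L$ with $b<a<c$. It is discrete if every non-greatest element has an immediate successor and every non-least element has an immediate predecessor.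
   Formalization: The discreteness claim is stated only for L not a one-point order: a one-point L is transitive and vacuously discrete, but its product with the rationals (cyclically transitive) is a copy of the rationals, which is not discrete. *)

theory Defs
  imports Complex_Main
begin

text \<open>
  A linear order is a reflexive relation \<open>r\<close> with \<open>Linear_order r\<close>; its underlying set is
  \<open>Field r\<close>, and \<open>(a, b) \<in> r\<close> is read \<open>a \<le> b\<close>. The empty order \<open>r = {}\<close> is included.
  Order isomorphisms are \<open>iso\<close>; although it comes from the theory of well-orders,
  \<open>iso_iff2\<close> shows that it is the usual notion for arbitrary relations.
\<close>

definition colex_prod :: "'a rel \<Rightarrow> 'b rel \<Rightarrow> ('a \<times> 'b) rel"  (infixr \<open>\<cdot>\<^sub>o\<close> 80) where
  "r \<cdot>\<^sub>o s = {((x, y), (x', y')).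
      (x \<in> Field r \<and> x' \<in> Field r \<and> (y, y') \<in> s - Id) \<or>
      ((x, x') \<in> r \<and> y \<in> Field s \<and> y' = y)}"

definition transitive_order :: "'a rel \<Rightarrow> bool" where
  "transitive_order r \<longleftrightarrow>
     (\<forall>a \<in> Field r. \<forall>b \<in> Field r. \<exists>\<phi>. iso r r \<phi> \<and> \<phi> a = b)"

text \<open>\<open>order_partition r A B\<close> is the partition \<open>r = A + B\<close>; \<open>ofilter r A\<close> says that \<open>A\<close> is an
  initial segment. Either part may be empty.\<close>

definition order_partition :: "'a rel \<Rightarrow> 'a set \<Rightarrow> 'a set \<Rightarrow> bool" where
  "order_partition r A B \<longleftrightarrow> ofilter r A \<and> B = Field r - A"

definition cyclically_transitive :: "'a rel \<Rightarrow> bool" where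
  "cyclically_transitive r \<longleftrightarrow>
     (\<forall>a b. (a, b) \<in> r \<longrightarrow>
       (\<exists>L1 L2 L2' L1' F1 F2.
          order_partition r L1 L2 \<and> order_partition r L2' L1' \<and>
          a \<in> L1 \<and> b \<in> L1' \<and>
          iso (Restr r L1) (Restr r L1') F1 \<and>
          iso (Restr r L2) (Restr r L2') F2 \<and>
          F1 a = b))"

definition unbounded_order :: "'a rel \<Rightarrow> bool" where
  "unbounded_order r \<longleftrightarrow>
     (\<forall>a \<in> Field r. \<exists>b c. (b, a) \<in> r - Id \<and> (a, c) \<in> r - Id)"

definition immediate_succ :: "'a rel \<Rightarrow> 'a \<Rightarrow> 'a \<Rightarrow> bool" where
  "immediate_succ r a b \<longleftrightarrow>
     (a, b) \<in> r - Id \<and> \<not> (\<exists>c. (a, c) \<in> r - Id \<and> (c, b) \<in> r - Id)"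

definition discrete_order :: "'a rel \<Rightarrow> bool" where
  "discrete_order r \<longleftrightarrow>
     (\<forall>a \<in> Field r. \<not> (\<forall>x \<in> Field r. (x, a) \<in> r) \<longrightarrow> (\<exists>b. immediate_succ r a b)) \<and>
     (\<forall>a \<in> Field r. \<not> (\<forall>x \<in> Field r. (a, x) \<in> r) \<longrightarrow> (\<exists>b. immediate_succ r b a))"

lemma Field_colex_prod:
  assumes "Linear_order r" "Linear_order s"
  shows "Field (r \<cdot>\<^sub>o s) = Field r \<times> Field s"
  using assms unfolding order_on_defs refl_on_def
  by (fastforce simp: colex_prod_def Field_def)

lemma Linear_order_colex_prod:
  assumes "Linear_order r" "Linear_order s"
  shows "Linear_order (r \<cdot>\<^sub>o s)"
proof -
  have F: "Field (r \<cdot>\<^sub>o s) = Field r \<times> Field s"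
    by (rule Field_colex_prod[OF assms])
  have "refl_on (Field r) r" "trans r" "antisym r" "total_on (Field r) r"
    and "refl_on (Field s) s" "trans s" "antisym s" "total_on (Field s) s"
    using assms by (auto simp: order_on_defs)
  note rs = this
  have "(p, p) \<in> r \<cdot>\<^sub>o s" if "p \<in> Field r \<times> Field s" for p
    using that rs by (auto simp: colex_prod_def refl_on_def)
  moreover have "trans (r \<cdot>\<^sub>o s)"
  proof (rule transI)
    fix p q t assume "(p, q) \<in> r \<cdot>\<^sub>o s" "(q, t) \<in> r \<cdot>\<^sub>o s"
    then show "(p, t) \<in> r \<cdot>\<^sub>o s"
      using rs by (auto simp: colex_prod_def FieldI1 FieldI2 dest: transD antisymD)
  qed
  moreover have "antisym (r \<cdot>\<^sub>o s)"
    using rs by (auto simp: antisym_def colex_prod_def)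
  moreover have "total_on (Field r \<times> Field s) (r \<cdot>\<^sub>o s)"
    using rs by (fastforce simp: total_on_def colex_prod_def)
  ultimately show ?thesis
    unfolding order_on_defs F by (auto simp: refl_on_def F[symmetric] FieldI1 FieldI2)
qed

text \<open>
  Discreteness does not pass from \<open>L\<close> to the product when \<open>L\<close> is a singleton: such an \<open>L\<close> is
  transitive and (vacuously) discrete, but \<open>L \<cdot>\<^sub>o M\<close> is then a copy of \<open>M\<close>, and for instance the
  rationals are cyclically transitive and not discrete. A statement about discreteness of the
  product therefore has to exclude a singleton first factor.
\<close>

lemma singleton_discrete_counterexample:
  defines "L \<equiv> {((), ())}" and "M \<equiv> {(x, y :: rat). x \<le> y}"
  shows "Linear_order L" "transitive_order L" "discrete_order L"
    and "Linear_order M" "cyclically_transitive M" "\<not> discrete_order (L \<cdot>\<^sub>o M)"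
proof -
  have FL: "Field L = UNIV" and FM: "Field M = UNIV"
    by (auto simp: L_def M_def Field_def)
  show "Linear_order L" "transitive_order L" "discrete_order L"
    unfolding order_on_defs transitive_order_def discrete_order_def iso_iff2 FL
    by (auto simp: L_def refl_on_def trans_def antisym_def total_on_def)
  show "Linear_order M"
    unfolding order_on_defs FM
    by (auto simp: M_def refl_on_def trans_def antisym_def total_on_def)
  show "cyclically_transitive M"
    unfolding cyclically_transitive_def
  proof (intro allI impI)
    fix a b :: rat
    have "iso M M (\<lambda>x. x + (b - a))"
      unfolding iso_iff2 FM by (auto simp: M_def bij_betw_def inj_on_def intro: surjI[where f = "\<lambda>x. x - (b - a)"])
    then show "\<exists>L1 L2 L2' L1' F1 F2.
          order_partition M L1 L2 \<and> order_partition M L2' L1' \<and>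
          a \<in> L1 \<and> b \<in> L1' \<and>
          iso (Restr M L1) (Restr M L1') F1 \<and>
          iso (Restr M L2) (Restr M L2') F2 \<and> F1 a = b"
      by (intro exI[of _ UNIV] exI[of _ "{}"] exI[of _ "\<lambda>x. x + (b - a)"] exI[of _ id])
         (auto simp: order_partition_def ofilter_def FM iso_iff2)
  qed
  have lt: "(((), x), ((), y)) \<in> L \<cdot>\<^sub>o M - Id \<longleftrightarrow> x < y" for x y
    by (auto simp: colex_prod_def L_def M_def)
  have "\<not> immediate_succ (L \<cdot>\<^sub>o M) ((), 0) p" for p
  proof (cases p)
    case (Pair u y)
    then show ?thesis
      using dense[of 0 y] lt unfolding immediate_succ_def by (metis (full_types) old.unit.exhaust)
  qed
  moreover have "((), 0) \<in> Field (L \<cdot>\<^sub>o M)" "((), 1) \<in> Field (L \<cdot>\<^sub>o M)"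
    using Field_colex_prod[OF \<open>Linear_order L\<close> \<open>Linear_order M\<close>] FL FM by auto
  moreover have "(((), 1), ((), 0)) \<notin> L \<cdot>\<^sub>o M"
    by (auto simp: colex_prod_def L_def M_def)
  ultimately show "\<not> discrete_order (L \<cdot>\<^sub>o M)"
    unfolding discrete_order_def by blast
qed

end

theory Submission
  imports Defs
begin

text \<open>The product replaces each point of \<open>M\<close> by a copy of \<open>L\<close>, so a
  cut of \<open>M\<close> lifts to a cut of the product. If (a,x) \<le> (b,y), then x \<le> y, and
  cyclic transitivity gives M = A + B = B' + A' with isomorphisms F : A \<rightarrow> A' and G : B
  \<rightarrow> B', where F x = y. Taking the cylinders over these parts cuts the product the same
  way. An automorphism \<phi> of \<open>L\<close> with \<phi> a = b, applied in the first coordinate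
  alongside F and G, gives the required isomorphisms
  (\<open>cyclically_transitive_colex_prod\<close>). Unboundedness and discreteness are found inside
  a single copy of \<open>L\<close>: a nontrivial transitive order has no endpoints
  (\<open>transitive_order_imp_unbounded_order\<close>), and neighbours within a copy stay
  neighbours in the product (\<open>immediate_succ_colex_prod\<close>).\<close>

lemma iso_colex_prod:
  assumes "Linear_order r" "Linear_order s" "Linear_order r'" "Linear_order s'"
    and f: "iso r r' f" and g: "iso s s' g"
  shows "iso (r \<cdot>\<^sub>o s) (r' \<cdot>\<^sub>o s') (map_prod f g)"
proof -
  have bij: "bij_betw f (Field r) (Field r')" "bij_betw g (Field s) (Field s')"
    and mono: "\<And>a b. a \<in> Field r \<Longrightarrow> b \<in> Field r \<Longrightarrow> (f a, f b) \<in> r' \<longleftrightarrow> (a, b) \<in> r"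
      "\<And>a b. a \<in> Field s \<Longrightarrow> b \<in> Field s \<Longrightarrow> (g a, g b) \<in> s' \<longleftrightarrow> (a, b) \<in> s"
    using f g by (auto simp: iso_iff2)
  have "g a = g b \<longleftrightarrow> a = b" if "a \<in> Field s" "b \<in> Field s" for a b
    using bij(2) that by (auto simp: bij_betw_def inj_on_def)
  moreover have "f a \<in> Field r'" if "a \<in> Field r" for a
    using bij(1) that by (auto simp: bij_betw_def)
  moreover have "g a \<in> Field s'" if "a \<in> Field s" for a
    using bij(2) that by (auto simp: bij_betw_def)
  moreover have "bij_betw (map_prod f g) (Field r \<times> Field s) (Field r' \<times> Field s')"
    using bij by (simp add: bij_betw_def map_prod_inj_on map_prod_surj_on)
  ultimately show ?thesis
    unfolding iso_iff2 Field_colex_prod[OF assms(1,2)] Field_colex_prod[OF assms(3,4)]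
    by (auto simp: colex_prod_def mono)
qed

text \<open>Cyclic transitivity asks for isomorphisms between restrictions of the product; seen as
  products, these fall under \<open>iso_colex_prod\<close>.\<close>

lemma Restr_colex_prod:
  assumes "Linear_order s" "A \<subseteq> Field s"
  shows "Restr (r \<cdot>\<^sub>o s) (Field r \<times> A) = r \<cdot>\<^sub>o Restr s A"
proof -
  have "Field (Restr s A) = A"
    using assms by (simp add: Refl_Field_Restr2 order_on_defs)
  then show ?thesis
    using assms(2) by (auto simp: colex_prod_def FieldI1 FieldI2)
qed

text \<open>Going down in the colexicographic order never raises the second coordinate, so a
  cylinder over an initial segment is itself initial.\<close>

lemma order_partition_colex_prod:
  assumes "Linear_order r" "Linear_order s" "order_partition s A B"
  shows "order_partition (r \<cdot>\<^sub>o s) (Field r \<times> A) (Field r \<times> B)"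
  using assms(3)
  unfolding order_partition_def ofilter_def under_def Field_colex_prod[OF assms(1,2)]
  by (auto simp: colex_prod_def FieldI1)

lemma cyclically_transitive_colex_prod:
  assumes r: "Linear_order r" "transitive_order r"
    and s: "Linear_order s" "cyclically_transitive s"
  shows "cyclically_transitive (r \<cdot>\<^sub>o s)"
  unfolding cyclically_transitive_def
proof (intro allI impI)
  fix p q assume pq: "(p, q) \<in> r \<cdot>\<^sub>o s"
  obtain a x b y where [simp]: "p = (a, x)" "q = (b, y)"
    by (cases p, cases q)
  have ab: "a \<in> Field r" "b \<in> Field r"
    using pq by (auto simp: colex_prod_def FieldI1 FieldI2)
  \<comment> \<open>Only the second coordinates are sure to be comparable in the right direction:
    when x < y, nothing relates a to b. Hence \<phi> below must come from full transitivity of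
    \<open>r\<close>.\<close>
  have "(x, y) \<in> s"
    using pq s(1) by (auto simp: colex_prod_def order_on_defs refl_on_def)
  then obtain A B B' A' F G where part: "order_partition s A B" "order_partition s B' A'"
    and mem: "x \<in> A" "y \<in> A'" "F x = y"
    and iso: "iso (Restr s A) (Restr s A') F" "iso (Restr s B) (Restr s B') G"
    using s(2) unfolding cyclically_transitive_def by meson
  obtain \<phi> where \<phi>: "iso r r \<phi>" "\<phi> a = b"
    using r(2) ab unfolding transitive_order_def by blast
  have sub: "A \<subseteq> Field s" "B \<subseteq> Field s" "A' \<subseteq> Field s" "B' \<subseteq> Field s"
    using part by (auto simp: order_partition_def ofilter_def)
  have lin: "Linear_order (Restr s C)" for C
    by (rule Linear_order_Restr[OF s(1)])
  \<comment> \<open>One \<phi> serves both parts of the cut: only the image of \<open>p\<close> is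
    prescribed, so on the second part any automorphism of \<open>r\<close> would do.\<close>
  have *: "iso (Restr (r \<cdot>\<^sub>o s) (Field r \<times> C)) (Restr (r \<cdot>\<^sub>o s) (Field r \<times> D)) (map_prod \<phi> H)"
    if "C \<subseteq> Field s" "D \<subseteq> Field s" "iso (Restr s C) (Restr s D) H" for C D H
    using iso_colex_prod[OF r(1) lin r(1) lin \<phi>(1) that(3)] Restr_colex_prod[OF s(1)] that
    by metis
  show "\<exists>L1 L2 L2' L1' F1 F2.
          order_partition (r \<cdot>\<^sub>o s) L1 L2 \<and> order_partition (r \<cdot>\<^sub>o s) L2' L1' \<and>
          p \<in> L1 \<and> q \<in> L1' \<and>
          iso (Restr (r \<cdot>\<^sub>o s) L1) (Restr (r \<cdot>\<^sub>o s) L1') F1 \<and>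
          iso (Restr (r \<cdot>\<^sub>o s) L2) (Restr (r \<cdot>\<^sub>o s) L2') F2 \<and> F1 p = q"
    by (rule exI[of _ "Field r \<times> A"], rule exI[of _ "Field r \<times> B"],
        rule exI[of _ "Field r \<times> B'"], rule exI[of _ "Field r \<times> A'"],
        rule exI[of _ "map_prod \<phi> F"], rule exI[of _ "map_prod \<phi> G"])
      (use order_partition_colex_prod[OF r(1) s(1)] part mem ab \<phi>(2) * sub iso in simp)
qed

lemma unbounded_order_colex_prod:
  assumes "Linear_order r" "Linear_order s" "unbounded_order r"
  shows "unbounded_order (r \<cdot>\<^sub>o s)"
  unfolding unbounded_order_def Field_colex_prod[OF assms(1,2)]
proof
  fix p assume "p \<in> Field r \<times> Field s"
  then obtain a x where [simp]: "p = (a, x)" and mem: "a \<in> Field r" "x \<in> Field s"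
    by auto
  obtain b c where "(b, a) \<in> r - Id" "(a, c) \<in> r - Id"
    using assms(3) mem(1) unfolding unbounded_order_def by blast
  then have "((b, x), p) \<in> r \<cdot>\<^sub>o s - Id \<and> (p, (c, x)) \<in> r \<cdot>\<^sub>o s - Id"
    using mem by (auto simp: colex_prod_def)
  then show "\<exists>b c. (b, p) \<in> r \<cdot>\<^sub>o s - Id \<and> (p, c) \<in> r \<cdot>\<^sub>o s - Id"
    by blast
qed

text \<open>By antisymmetry of \<open>s\<close>, a point between (a,x) and (b,x) again has second
  coordinate x, so its first coordinate would lie between a and b.\<close>

lemma immediate_succ_colex_prod:
  assumes "Linear_order s" "immediate_succ r a b" "x \<in> Field s"
  shows "immediate_succ (r \<cdot>\<^sub>o s) (a, x) (b, x)"
proof -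
  have "antisym s"
    using assms(1) by (simp add: order_on_defs)
  then show ?thesis
    using assms(2,3) unfolding immediate_succ_def
    by (auto simp: colex_prod_def dest: antisymD)
qed

text \<open>Unboundedness of \<open>r\<close> gives every point both neighbours in its own copy. At
  an endpoint of \<open>r\<close> a neighbour could lie only in another copy, and discreteness of
  \<open>s\<close> is not assumed.\<close>

lemma discrete_order_colex_prod:
  assumes "Linear_order r" "Linear_order s" "unbounded_order r" "discrete_order r"
  shows "discrete_order (r \<cdot>\<^sub>o s)"
proof -
  have anti: "antisym r"
    using assms(1) by (simp add: order_on_defs)
  have "\<exists>b c. immediate_succ r b a \<and> immediate_succ r a c" if a: "a \<in> Field r" for a
  proof -
    obtain b c where "(b, a) \<in> r - Id" "(a, c) \<in> r - Id"
      using assms(3) a unfolding unbounded_order_def by blast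
    then have "\<not> (\<forall>x \<in> Field r. (x, a) \<in> r)" "\<not> (\<forall>x \<in> Field r. (a, x) \<in> r)"
      using anti by (auto dest: antisymD FieldI1 FieldI2)
    then show ?thesis
      using assms(4) a unfolding discrete_order_def by blast
  qed
  then show ?thesis
    unfolding discrete_order_def Field_colex_prod[OF assms(1,2)]
    using immediate_succ_colex_prod[OF assms(2)] by fast
qed

lemma transitive_order_imp_unbounded_order:
  assumes "Linear_order r" "transitive_order r" "\<not> is_singleton (Field r)"
  shows "unbounded_order r"
  unfolding unbounded_order_def
proof
  fix a assume a: "a \<in> Field r"
  obtain b where b: "b \<in> Field r" "b \<noteq> a"
    using assms(3) a is_singletonI'[of "Field r"] by (metis empty_iff)
  \<comment> \<open>Sending b to a, rather than a to b, puts \<phi> a on the opposite side of a from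
    b: if a < b then \<phi> a < \<phi> b = a, and dually. So b and \<phi> a are the two witnesses,
    in an order depending on the case.\<close>
  obtain \<phi> where \<phi>: "iso r r \<phi>" "\<phi> b = a"
    using assms(2) a b(1) unfolding transitive_order_def by blast
  have "\<phi> a \<noteq> a"
    using \<phi> a b by (auto simp: iso_iff2 bij_betw_def inj_on_def)
  moreover have "(\<phi> a, a) \<in> r \<longleftrightarrow> (a, b) \<in> r" "(a, \<phi> a) \<in> r \<longleftrightarrow> (b, a) \<in> r"
    using \<phi> a b by (auto simp: iso_iff2)
  moreover have "(a, b) \<in> r \<or> (b, a) \<in> r"
    using assms(1) a b by (auto simp: order_on_defs total_on_def)
  ultimately show "\<exists>b c. (b, a) \<in> r - Id \<and> (a, c) \<in> r - Id"
    using b(2) by (metis DiffI pair_in_Id_conv)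
qed

theorem theorem4p12:
  fixes L :: "'a rel" and M :: "'b rel"
  assumes "Linear_order L" and "transitive_order L"
    and "Linear_order M" and "cyclically_transitive M"
  shows "cyclically_transitive (L \<cdot>\<^sub>o M) \<and>
    (unbounded_order L \<longrightarrow> unbounded_order (L \<cdot>\<^sub>o M)) \<and>
    (discrete_order L \<and> \<not> is_singleton (Field L) \<longrightarrow> discrete_order (L \<cdot>\<^sub>o M))"
  using assms
  by (simp add: cyclically_transitive_colex_prod unbounded_order_colex_prod
      discrete_order_colex_prod transitive_order_imp_unbounded_order)

end
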